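(* Let $H,\hat H\in\mathbb{R}^{M\times N}$ satisfy $\|H-\hat H\|_2\le\bar\varepsilon\,\|H\|_2$ for some $\bar\varepsilon\ge 0$, let $y\in\mathbb{R}^M$, and let $\mu:\mathbb{R}^{N_p}\to\mathbb{R}^N$ be differentiable with Jacobian matrix $\frac{\partial\mu}{\partial p}\in\mathbb{R}^{N\times N_p}$. Define $$f(p)=\|y-H\mu(p)\|_2^2,\qquad \hat f(p)=\|y-\hat H\mu(p)\|_2^2,$$ $$g(p)=-\Big(\frac{\partial\mu}{\partial p}\Big)^TH^T\big(y-H\mu(p)\big),\qquad \hat g(p)=-\Big(\frac{\partial\mu}{\partial p}\Big)^T\hat H^T\big(y-\hat H\mu(p)\big).$$ Then at every $p$, writing $\mu=\mu(p)$, $$|f-\hat f|\le 2\bar\varepsilon\,\|y-\hat H\mu\|_2\,\|H\|_2\,\|\mu\|_2+O(\bar\varepsilon^2),$$ $$\|g-\hat g\|_2\le\bar\varepsilon\,\Big\|\frac{\partial\mu}{\partial p}\Big\|_2\,\|H\|_2\Big(\|\mu\|_2\|H\|_2+\|y-\hat H\mu\|_2\Big),$$ where $O(\bar\varepsilon^2)$ denotes a quantity bounded by $C\bar\varepsilon^2$ with $C$ depending only on $\|H\|_2$ and $\|\mu\|_2$.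
   Context: $\|\cdot\|_2$ is the Euclidean vector norm and the induced spectral matrix norm. $H$ is the (weighted) measurement operator, $\hat H$ its low-rank approximation, $y$ the weighted data, and $\mu(p)$ the discretized shape depending on the shape parameters $p$. The vectors $g$ and $\hat g$ are what is called the gradient of $f$ and of $\hat f$ (with the factor $2$ omitted by convention). *)

theory Defs
  imports "HOL-Analysis.L2_Norm" "Jordan_Normal_Form.Matrix"
begin

(* Vectors of R^n and real matrices are the carrier-based ones of Jordan_Normal_Form: the
   constant in the O-term depends only on two norms, so it is chosen before the dimensions,
   and dimensions that are types could not be quantified after it. The types vec and mat
   are not normed spaces, hence the carrier-relative norms and derivative below. *)

definition vnorm :: "real vec \<Rightarrow> real" where
  "vnorm v = L2_set (\<lambda>i. v $ i) {..<dim_vec v}"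

(* As in onorm, the zero vector contributes the quotient 0 / 0 = 0; the supremum is over a
   nonempty set, bounded above because the dimension is finite. *)
definition spectral_norm :: "real mat \<Rightarrow> real" where
  "spectral_norm A = (SUP x\<in>carrier_vec (dim_col A). vnorm (A *\<^sub>v x) / vnorm x)"

(* Total (Frechet) differentiability at p, where A is the matrix of the derivative; A is
   uniquely determined, and its entry (i, j) is the j-th partial derivative of the
   i-th component. *)
definition has_jacobian :: "(real vec \<Rightarrow> real vec) \<Rightarrow> real mat \<Rightarrow> real vec \<Rightarrow> bool" where
  "has_jacobian \<mu> A p \<longleftrightarrow>
     A \<in> carrier_mat (dim_vec (\<mu> p)) (dim_vec p) \<and>
     (\<forall>e>0. \<exists>d>0. \<forall>q\<in>carrier_vec (dim_vec p). vnorm (q - p) < d \<longrightarrow>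
        vnorm (\<mu> q - \<mu> p - A *\<^sub>v (q - p)) \<le> e * vnorm (q - p))"

definition misfit :: "real mat \<Rightarrow> real vec \<Rightarrow> (real vec \<Rightarrow> real vec) \<Rightarrow> real vec \<Rightarrow> real" where
  "misfit H y \<mu> p = (vnorm (y - H *\<^sub>v \<mu> p))\<^sup>2"

(* J p is the Jacobian of \<mu> at p; by convention the factor 2 of the true gradient of the
   misfit is omitted. *)
definition misfit_gradient ::
  "real mat \<Rightarrow> real vec \<Rightarrow> (real vec \<Rightarrow> real vec) \<Rightarrow> (real vec \<Rightarrow> real mat) \<Rightarrow> real vec \<Rightarrow> real vec" where
  "misfit_gradient H y \<mu> J p =
     - (transpose_mat (J p) *\<^sub>v (transpose_mat H *\<^sub>v (y - H *\<^sub>v \<mu> p)))"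

end

(* With E = H - H' and the residual r = y - H' mu, the other residual is y - H mu = r - E mu.
   Expanding the square leaves |E mu|^2 - 2 <r, E mu>, so C can be taken to be |H|^2 |mu|^2;
   the gradients differ by -J^T (E^T r - H^T E mu), which is exact and hence needs no O-term. *)

theory Submission
  imports Defs
begin

lemma vnorm_nonneg [simp]: "0 \<le> vnorm v"
  by (simp add: vnorm_def)

lemma vnorm_power2: "(vnorm v)\<^sup>2 = v \<bullet> v"
  by (simp add: vnorm_def L2_set_def scalar_prod_def sum_nonneg lessThan_atLeast0 power2_eq_square)

lemma vnorm_uminus [simp]: "vnorm (- v) = vnorm v"
  by (simp add: vnorm_def L2_set_def)

text \<open>Cauchy-Schwarz: the triangle inequality moves the absolute value onto the factors, where
  \<open>L2_set_mult_ineq\<close> applies.\<close>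

lemma scalar_prod_le_vnorm:
  assumes "v \<in> carrier_vec n" "w \<in> carrier_vec n"
  shows "\<bar>v \<bullet> w\<bar> \<le> vnorm v * vnorm w"
proof -
  have "\<bar>v \<bullet> w\<bar> \<le> (\<Sum>i<n. \<bar>v $ i\<bar> * \<bar>w $ i\<bar>)"
    using assms sum_abs[of "\<lambda>i. v $ i * w $ i" "{..<n}"]
    by (simp add: scalar_prod_def lessThan_atLeast0 abs_mult)
  also have "\<dots> \<le> vnorm v * vnorm w"
    using assms L2_set_mult_ineq[of "\<lambda>i. v $ i" "\<lambda>i. w $ i" "{..<n}"]
    by (simp add: vnorm_def)
  finally show ?thesis .
qed

lemma vnorm_diff_power2:
  assumes "v \<in> carrier_vec n" "w \<in> carrier_vec n"
  shows "(vnorm (v - w))\<^sup>2 = (vnorm v)\<^sup>2 - 2 * (v \<bullet> w) + (vnorm w)\<^sup>2"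
  using assms
  by (simp add: vnorm_power2 minus_scalar_prod_distrib[of _ n] scalar_prod_minus_distrib[of _ n]
      comm_scalar_prod[of w n v])

text \<open>Triangle inequality in the form used for differences: compare squares and bound the
  cross term by Cauchy-Schwarz.\<close>

lemma vnorm_diff_le:
  assumes "v \<in> carrier_vec n" "w \<in> carrier_vec n"
  shows "vnorm (v - w) \<le> vnorm v + vnorm w"
proof (rule power2_le_imp_le)
  show "(vnorm (v - w))\<^sup>2 \<le> (vnorm v + vnorm w)\<^sup>2"
    using scalar_prod_le_vnorm[OF assms] by (simp add: vnorm_diff_power2[OF assms] power2_sum)
qed simp

text \<open>A crude bound, each entry of the product being a scalar product with a row. It makes the
  supremum in \<open>spectral_norm\<close> one over a bounded set, and it shows that vectors of norm
  0 are sent to vectors of norm 0.\<close>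

lemma vnorm_mult_mat_vec_bounded:
  assumes "x \<in> carrier_vec (dim_col A)"
  shows "vnorm (A *\<^sub>v x) \<le> (\<Sum>i<dim_row A. vnorm (row A i)) * vnorm x"
proof -
  have "vnorm (A *\<^sub>v x) \<le> (\<Sum>i<dim_row A. \<bar>(A *\<^sub>v x) $ i\<bar>)"
    using L2_set_le_sum_abs[of "\<lambda>i. (A *\<^sub>v x) $ i" "{..<dim_row A}"] by (simp add: vnorm_def)
  also have "\<dots> \<le> (\<Sum>i<dim_row A. vnorm (row A i) * vnorm x)"
    using assms by (intro sum_mono) (auto intro!: scalar_prod_le_vnorm[of _ "dim_col A"])
  finally show ?thesis by (simp add: sum_distrib_right)
qed

lemma bdd_above_spectral_quotients:
  "bdd_above ((\<lambda>x. vnorm (A *\<^sub>v x) / vnorm x) ` carrier_vec (dim_col A))"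
proof (rule bdd_aboveI2)
  fix x :: "real vec" assume x: "x \<in> carrier_vec (dim_col A)"
  show "vnorm (A *\<^sub>v x) / vnorm x \<le> (\<Sum>i<dim_row A. vnorm (row A i))"
  proof (cases "vnorm x = 0")
    case True
    \<comment> \<open>Division by zero yields 0, so a nonnegative bound suffices.\<close>
    then show ?thesis by (simp add: sum_nonneg)
  next
    case False
    then have "0 < vnorm x" using vnorm_nonneg[of x] by linarith
    then show ?thesis
      using vnorm_mult_mat_vec_bounded[OF x] by (simp add: pos_divide_le_eq)
  qed
qed

lemma spectral_norm_nonneg: "0 \<le> spectral_norm A"
proof -
  \<comment> \<open>The zero vector lies in every carrier, so its quotient is a member of the set
    whose supremum is taken, even when \<open>dim_col A\<close> is 0.\<close>
  have "0 \<le> vnorm (A *\<^sub>v 0\<^sub>v (dim_col A)) / vnorm (0\<^sub>v (dim_col A))"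
    by simp
  also have "\<dots> \<le> spectral_norm A"
    unfolding spectral_norm_def by (rule cSUP_upper[OF _ bdd_above_spectral_quotients]) simp
  finally show ?thesis .
qed

lemma vnorm_mult_mat_vec_le:
  assumes "A \<in> carrier_mat m n" "x \<in> carrier_vec n"
  shows "vnorm (A *\<^sub>v x) \<le> spectral_norm A * vnorm x"
proof (cases "vnorm x = 0")
  case True
  \<comment> \<open>The quotient at \<open>x\<close> is 0 by convention and says nothing about
    \<open>A *\<^sub>v x\<close>; the row bound does.\<close>
  then show ?thesis
    using vnorm_mult_mat_vec_bounded[of x A] assms by simp
next
  case False
  have "vnorm (A *\<^sub>v x) / vnorm x \<le> spectral_norm A"
    unfolding spectral_norm_def using assms
    by (intro cSUP_upper[OF _ bdd_above_spectral_quotients]) simp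
  moreover have "0 < vnorm x" using False vnorm_nonneg[of x] by linarith
  ultimately show ?thesis by (simp add: pos_divide_le_eq)
qed

text \<open>\<open>\<parallel>A\<^sup>T x\<parallel>\<^sup>2 = x \<bullet> A A\<^sup>T x\<close>, then Cauchy-Schwarz and cancellation.\<close>

lemma vnorm_mult_transpose_le:
  assumes A: "A \<in> carrier_mat m n" and x: "x \<in> carrier_vec m"
  shows "vnorm (transpose_mat A *\<^sub>v x) \<le> spectral_norm A * vnorm x"
proof -
  let ?z = "transpose_mat A *\<^sub>v x"
  have z: "?z \<in> carrier_vec n" using A x by auto
  have "vnorm ?z * vnorm ?z = ?z \<bullet> ?z"
    by (simp add: vnorm_power2 flip: power2_eq_square)
  also have "\<dots> = x \<bullet> (A *\<^sub>v ?z)"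
    by (rule transpose_vec_mult_scalar[OF A z x])
  also have "\<dots> \<le> vnorm x * vnorm (A *\<^sub>v ?z)"
    using scalar_prod_le_vnorm[of x m "A *\<^sub>v ?z"] x z A by simp
  also have "\<dots> \<le> vnorm x * (spectral_norm A * vnorm ?z)"
    by (intro mult_left_mono vnorm_mult_mat_vec_le[OF A z]) simp
  finally have *: "vnorm ?z * vnorm ?z \<le> (spectral_norm A * vnorm x) * vnorm ?z"
    by (simp add: ac_simps)
  show ?thesis
  proof (cases "vnorm ?z = 0")
    case True
    then show ?thesis by (simp add: spectral_norm_nonneg)
  next
    case False
    then have "0 < vnorm ?z" using vnorm_nonneg[of ?z] by linarith
    with * show ?thesis by (rule mult_right_le_imp_le)
  qed
qed

text \<open>The O-term with its constant made explicit: the cross term gives the part linear in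
  \<open>\<epsilon>\<close>, and the squared norm of \<open>e\<close> gives the quadratic
  part.\<close>

lemma misfit_perturbation_le:
  assumes H: "H \<in> carrier_mat M N" "H' \<in> carrier_mat M N" and y: "y \<in> carrier_vec M"
    and \<mu>: "\<mu> p \<in> carrier_vec N"
    and le: "spectral_norm (H - H') \<le> \<epsilon> * spectral_norm H"
  shows "\<bar>misfit H y \<mu> p - misfit H' y \<mu> p\<bar>
          \<le> 2 * \<epsilon> * vnorm (y - H' *\<^sub>v \<mu> p) * spectral_norm H * vnorm (\<mu> p)
            + (spectral_norm H * vnorm (\<mu> p))\<^sup>2 * \<epsilon>\<^sup>2"
proof -
  define r where "r = y - H' *\<^sub>v \<mu> p"
  define e where "e = (H - H') *\<^sub>v \<mu> p"
  have r: "r \<in> carrier_vec M" and e: "e \<in> carrier_vec M"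
    using H y \<mu> by (auto simp: r_def e_def intro!: mult_mat_vec_carrier minus_carrier_mat)
  \<comment> \<open>The residual of \<open>H'\<close> serves as reference, since it is the one that
    occurs in the bound.\<close>
  have split: "y - H *\<^sub>v \<mu> p = r - e"
    using H y \<mu> by (intro eq_vecI) (auto simp: r_def e_def minus_mult_distrib_mat_vec)
  have "vnorm e \<le> spectral_norm (H - H') * vnorm (\<mu> p)"
    unfolding e_def using H \<mu> by (intro vnorm_mult_mat_vec_le minus_carrier_mat) auto
  also have "\<dots> \<le> \<epsilon> * spectral_norm H * vnorm (\<mu> p)"
    using le by (intro mult_right_mono) auto
  finally have e_le: "vnorm e \<le> \<epsilon> * spectral_norm H * vnorm (\<mu> p)" .
  \<comment> \<open>The squared norm of \<open>r\<close> is the misfit for \<open>H'\<close> and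
    cancels.\<close>
  have "\<bar>misfit H y \<mu> p - misfit H' y \<mu> p\<bar> = \<bar>(vnorm e)\<^sup>2 - 2 * (r \<bullet> e)\<bar>"
    by (simp add: misfit_def split vnorm_diff_power2[OF r e] flip: r_def)
  also have "\<dots> \<le> 2 * (vnorm r * vnorm e) + (vnorm e)\<^sup>2"
    using scalar_prod_le_vnorm[OF r e] zero_le_power2[of "vnorm e"] by linarith
  also have "\<dots> \<le> 2 * (vnorm r * (\<epsilon> * spectral_norm H * vnorm (\<mu> p)))
      + (\<epsilon> * spectral_norm H * vnorm (\<mu> p))\<^sup>2"
    using e_le by (intro add_mono mult_left_mono power_mono) auto
  finally show ?thesis
    by (simp add: r_def power_mult_distrib ac_simps)
qed

text \<open>Both \<open>w\<close> and \<open>v\<close> below are linear in \<open>E\<close>, so the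
  hypothesis on the norm of \<open>E\<close> is applied once, to a common factor, and no power of
  \<open>\<epsilon>\<close> above the first arises.\<close>

lemma misfit_gradient_perturbation_le:
  assumes H: "H \<in> carrier_mat M N" "H' \<in> carrier_mat M N" and y: "y \<in> carrier_vec M"
    and \<mu>: "\<mu> p \<in> carrier_vec N" and J: "J p \<in> carrier_mat N n"
    and le: "spectral_norm (H - H') \<le> \<epsilon> * spectral_norm H"
  shows "vnorm (misfit_gradient H y \<mu> J p - misfit_gradient H' y \<mu> J p)
          \<le> \<epsilon> * spectral_norm (J p) * spectral_norm H
            * (vnorm (\<mu> p) * spectral_norm H + vnorm (y - H' *\<^sub>v \<mu> p))"
proof -
  define r where "r = y - H' *\<^sub>v \<mu> p"
  define E where "E = H - H'"
  define e where "e = E *\<^sub>v \<mu> p"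
  have E: "E \<in> carrier_mat M N" using H by (simp add: E_def minus_carrier_mat)
  have r: "r \<in> carrier_vec M" and e: "e \<in> carrier_vec M"
    using H E y \<mu> by (auto simp: r_def e_def)
  have split: "y - H *\<^sub>v \<mu> p = r - e"
    using H y \<mu> by (intro eq_vecI) (auto simp: r_def e_def E_def minus_mult_distrib_mat_vec)
  have E_r: "transpose_mat E *\<^sub>v r = transpose_mat H *\<^sub>v r - transpose_mat H' *\<^sub>v r"
    using H r minus_mult_distrib_mat_vec[of "transpose_mat H" N M "transpose_mat H'" r]
    by (simp add: E_def transpose_minus)
  define u where "u = transpose_mat H *\<^sub>v (r - e)"
  define u' where "u' = transpose_mat H' *\<^sub>v r"
  define v where "v = transpose_mat H *\<^sub>v e"
  define w where "w = transpose_mat E *\<^sub>v r"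
  have carrier: "u \<in> carrier_vec N" "u' \<in> carrier_vec N" "v \<in> carrier_vec N" "w \<in> carrier_vec N"
    using H E r e by (auto simp: u_def u'_def v_def w_def)
  have "u = transpose_mat H *\<^sub>v r - v"
    using H r e by (simp add: u_def v_def mult_minus_distrib_mat_vec[of _ N M])
  then have u_diff: "u - u' = w - v"
    using H r carrier by (intro eq_vecI) (auto simp: w_def E_r u'_def)
  \<comment> \<open>Both gradients have the same outer factor, the negated transpose of
    \<open>J p\<close>; its sign disappears under the norm.\<close>
  have "misfit_gradient H y \<mu> J p - misfit_gradient H' y \<mu> J p
      = - (transpose_mat (J p) *\<^sub>v (u - u'))"
    unfolding misfit_gradient_def split r_def[symmetric] u_def[symmetric] u'_def[symmetric]
    using J carrier by (intro eq_vecI) (auto simp: mult_minus_distrib_mat_vec[of _ n N])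
  then have "vnorm (misfit_gradient H y \<mu> J p - misfit_gradient H' y \<mu> J p)
      = vnorm (transpose_mat (J p) *\<^sub>v (w - v))"
    by (simp add: u_diff)
  \<comment> \<open>A transpose is bounded by the norm of the untransposed matrix, which puts
    \<open>J p\<close> here, and \<open>H\<close> and \<open>E\<close> below, into the
    estimate.\<close>
  also have "\<dots> \<le> spectral_norm (J p) * vnorm (w - v)"
    using J carrier by (intro vnorm_mult_transpose_le) auto
  also have "\<dots> \<le> spectral_norm (J p)
      * (\<epsilon> * spectral_norm H * (vnorm (\<mu> p) * spectral_norm H + vnorm r))"
  proof (rule mult_left_mono[OF _ spectral_norm_nonneg])
    have w_le: "vnorm w \<le> spectral_norm E * vnorm r"
      unfolding w_def by (rule vnorm_mult_transpose_le[OF E r])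
    have "vnorm v \<le> spectral_norm H * vnorm e"
      unfolding v_def by (rule vnorm_mult_transpose_le[OF H(1) e])
    also have "\<dots> \<le> spectral_norm H * (spectral_norm E * vnorm (\<mu> p))"
      unfolding e_def
      by (intro mult_left_mono vnorm_mult_mat_vec_le[OF E \<mu>] spectral_norm_nonneg)
    \<comment> \<open>The summand with \<open>vnorm r\<close> comes from \<open>w\<close>; the one
      with \<open>\<mu> p\<close> comes from \<open>v\<close>, where \<open>H\<close> acts once more
      on \<open>e\<close>.\<close>
    finally have "vnorm (w - v) \<le> spectral_norm E * (vnorm (\<mu> p) * spectral_norm H + vnorm r)"
      using w_le vnorm_diff_le[OF carrier(4,3)] by (simp add: algebra_simps)
    also have "\<dots> \<le> \<epsilon> * spectral_norm H * (vnorm (\<mu> p) * spectral_norm H + vnorm r)"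
      using le by (intro mult_right_mono) (auto simp: E_def spectral_norm_nonneg)
    finally show "vnorm (w - v)
        \<le> \<epsilon> * spectral_norm H * (vnorm (\<mu> p) * spectral_norm H + vnorm r)" .
  qed
  finally show ?thesis
    by (simp add: r_def ac_simps)
qed

text \<open>\<open>C\<close> is a function of two reals fixed before all other data, which expresses
  that the constant depends only on the two norms.\<close>

theorem mainTheorem3:
  shows "\<exists>C :: real \<Rightarrow> real \<Rightarrow> real.
    \<forall>(M::nat) (N::nat) (Np::nat) (H::real mat) (H'::real mat) (\<epsilon>::real) (y::real vec)
      (\<mu>::real vec \<Rightarrow> real vec) (J::real vec \<Rightarrow> real mat).
      H \<in> carrier_mat M N \<longrightarrow> H' \<in> carrier_mat M N \<longrightarrow>
      0 \<le> \<epsilon> \<longrightarrow> spectral_norm (H - H') \<le> \<epsilon> * spectral_norm H \<longrightarrow>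
      y \<in> carrier_vec M \<longrightarrow>
      (\<forall>p\<in>carrier_vec Np. \<mu> p \<in> carrier_vec N) \<longrightarrow>
      (\<forall>p\<in>carrier_vec Np. has_jacobian \<mu> (J p) p) \<longrightarrow>
      (\<forall>p\<in>carrier_vec Np.
        \<bar>misfit H y \<mu> p - misfit H' y \<mu> p\<bar>
          \<le> 2 * \<epsilon> * vnorm (y - H' *\<^sub>v \<mu> p) * spectral_norm H * vnorm (\<mu> p)
            + C (spectral_norm H) (vnorm (\<mu> p)) * \<epsilon>\<^sup>2 \<and>
        vnorm (misfit_gradient H y \<mu> J p - misfit_gradient H' y \<mu> J p)
          \<le> \<epsilon> * spectral_norm (J p) * spectral_norm H
            * (vnorm (\<mu> p) * spectral_norm H + vnorm (y - H' *\<^sub>v \<mu> p)))"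
\<comment> \<open>The witness is the square of the bound on \<open>vnorm e\<close>, with the factor
  \<open>\<epsilon>\<close> split off.\<close>
proof (rule exI[of _ "\<lambda>h m. (h * m)\<^sup>2"], intro allI impI ballI conjI)
  fix M N Np H H' \<epsilon> \<mu> J and y p :: "real vec"
  assume H: "H \<in> carrier_mat M N" "H' \<in> carrier_mat M N" and "(0::real) \<le> \<epsilon>"
    and le: "spectral_norm (H - H') \<le> \<epsilon> * spectral_norm H" and y: "y \<in> carrier_vec M"
    and "\<forall>p\<in>carrier_vec Np. \<mu> p \<in> carrier_vec N" "\<forall>p\<in>carrier_vec Np. has_jacobian \<mu> (J p) p"
    and "p \<in> carrier_vec Np"
  then have \<mu>: "\<mu> p \<in> carrier_vec N" and "has_jacobian \<mu> (J p) p" and "dim_vec p = Np"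
    by auto
  \<comment> \<open>The shape of \<open>J p\<close> is read off from \<open>has_jacobian\<close>,
    whose dimensions are those of \<open>\<mu> p\<close> and \<open>p\<close>.\<close>
  then have J: "J p \<in> carrier_mat N Np"
    unfolding has_jacobian_def by simp
  show "\<bar>misfit H y \<mu> p - misfit H' y \<mu> p\<bar>
      \<le> 2 * \<epsilon> * vnorm (y - H' *\<^sub>v \<mu> p) * spectral_norm H * vnorm (\<mu> p)
        + (spectral_norm H * vnorm (\<mu> p))\<^sup>2 * \<epsilon>\<^sup>2"
    using misfit_perturbation_le[where \<mu> = \<mu>, OF H y \<mu> le] .
  show "vnorm (misfit_gradient H y \<mu> J p - misfit_gradient H' y \<mu> J p)
      \<le> \<epsilon> * spectral_norm (J p) * spectral_norm H
        * (vnorm (\<mu> p) * spectral_norm H + vnorm (y - H' *\<^sub>v \<mu> p))"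
    using misfit_gradient_perturbation_le[where \<mu> = \<mu> and J = J, OF H y \<mu> J le] .
qed

end
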